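(* Let $A\in\mathbb{R}^{n\times n}$, and let $\mathcal{E}=\{x\in\mathbb{R}^n : x^TQx\le 1\}$ be an ellipsoid, where $Q\in\mathbb{R}^{n\times n}$ is symmetric positive definite. Assume that $\mathcal{E}$ is an invariant set for the continuous system $\dot{x}(t)=Ax(t)$. Then there exists $\hat\tau>0$ such that for every $x_k\in\mathcal{E}$ and every $\Delta t\in[0,\hat\tau]$, we have $x_{k+1}\in\mathcal{E}$, where $x_{k+1}=(I-\Delta t A)^{-1}x_k$ is obtained by the backward Euler method; i.e., $\mathcal{E}$ is an invariant set for the discrete system $x_{k+1}=(I-\Delta t A)^{-1}x_k$ for every such $\Delta t$.
   Context: A set $\mathcal{S}$ is an invariant set for $\dot x(t)=Ax(t)$ if $x(0)\in\mathcal{S}$ implies $x(t)\in\mathcal{S}$ for all $t\ge0$. It is an invariant set for a discrete system $x_{k+1}=Mx_k$ if $x_k\in\mathcal{S}$ implies $x_{k+1}\in\mathcal{S}$ for all $k\in\mathbb{N}$. A statement about $x_{k+1}=(I-\Delta t A)^{-1}x_k$ is understood to include that $I-\Delta t A$ is nonsingular. *)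

theory Defs
  imports "HOL-Analysis.Analysis"
begin

definition symmetric_pos_def :: "real^'n^'n \<Rightarrow> bool" where
  "symmetric_pos_def Q \<longleftrightarrow> transpose Q = Q \<and> (\<forall>x. x \<noteq> 0 \<longrightarrow> x \<bullet> (Q *v x) > 0)"

definition ellipsoid :: "real^'n^'n \<Rightarrow> (real^'n) set" where
  "ellipsoid Q = {x. x \<bullet> (Q *v x) \<le> 1}"

text \<open>A trajectory is a solution on the half-line of nonnegative times, so at time 0 the
  derivative is one-sided; values at negative times are irrelevant.\<close>

definition continuous_trajectory :: "real^'n^'n \<Rightarrow> (real \<Rightarrow> real^'n) \<Rightarrow> bool" where
  "continuous_trajectory A x \<longleftrightarrow>
     (\<forall>t\<ge>0. (x has_vector_derivative A *v x t) (at t within {0..}))"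

definition continuous_invariant :: "real^'n^'n \<Rightarrow> (real^'n) set \<Rightarrow> bool" where
  "continuous_invariant A S \<longleftrightarrow>
     (\<forall>x. continuous_trajectory A x \<longrightarrow> x 0 \<in> S \<longrightarrow> (\<forall>t\<ge>0. x t \<in> S))"

definition discrete_trajectory :: "real^'n^'n \<Rightarrow> (nat \<Rightarrow> real^'n) \<Rightarrow> bool" where
  "discrete_trajectory M x \<longleftrightarrow> (\<forall>k. x (Suc k) = M *v x k)"

definition discrete_invariant :: "real^'n^'n \<Rightarrow> (real^'n) set \<Rightarrow> bool" where
  "discrete_invariant M S \<longleftrightarrow>
     (\<forall>x. discrete_trajectory M x \<longrightarrow> (\<forall>k. x k \<in> S \<longrightarrow> x (Suc k) \<in> S))"

text \<open>The library's \<open>matrix_inv\<close> is unspecified on singular matrices, so statements about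
  the backward Euler system must assert nonsingularity of \<open>I - dt A\<close> separately.\<close>

definition backward_euler :: "real^'n^'n \<Rightarrow> real \<Rightarrow> real^'n^'n" where
  "backward_euler A dt = matrix_inv (mat 1 - dt *\<^sub>R A)"

end

theory Submission
  imports Defs
begin

text \<open>
  Write \<open>V x = x \<bullet> (Q *v x)\<close>. Invariance of the ellipsoid forces the dissipativity inequality
  \<open>x \<bullet> (Q *v (A *v x)) \<le> 0\<close> for every \<open>x\<close> (\<open>invariant_imp_dissipative\<close>): on the trajectory that
  starts at a boundary point the function \<open>V\<close> starts at its maximal admissible value \<open>1\<close>, so its
  right derivative at time \<open>0\<close>, which is twice the left-hand side of the inequality, cannot be
  positive; all other points follow by homogeneity. This uses that a trajectory through each point
  exists, namely the exponential series (\<open>exists_continuous_trajectory\<close>).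

  Conversely, if \<open>y\<close> is the backward Euler successor of \<open>x\<close>, then \<open>x = y - dt *\<^sub>R (A *v y)\<close>, and
  expanding the square gives
  \<open>V x = V y - 2 * dt * (y \<bullet> (Q *v (A *v y))) + dt\<^sup>2 * V (A *v y) \<ge> V y\<close>
  (\<open>dissipative_imp_backward_step_expands\<close>). So \<open>V\<close> does not increase along the discrete system,
  and \<open>I - dt A\<close> is injective because \<open>x = 0\<close> forces \<open>V y \<le> 0\<close>. This holds for all \<open>dt \<ge> 0\<close>,
  so every positive bound on the step size is admissible.
\<close>

text \<open>The exponential series of \<open>t A\<close> applied to \<open>x0\<close>; working with the vectors \<open>A\<^sup>k x0\<close> instead
  of powers of \<open>A\<close> reduces everything to scalar power series, one for each coordinate.\<close>

lemma exists_continuous_trajectory: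
  fixes A :: "real^'n^'n" and x0 :: "real^'n"
  obtains x where "continuous_trajectory A x" and "x 0 = x0"
proof -
  define v where "v k = (((*v) A) ^^ k) x0" for k
  have v_Suc: "v (Suc k) = A *v v k" for k by (simp add: v_def)
  obtain K where K: "\<And>y. norm (A *v y) \<le> norm y * K"
    using bounded_linear.nonneg_bounded[OF matrix_vector_mul_bounded_linear[of A]] by blast
  have "K \<ge> 0"
    using order_trans[OF norm_ge_zero K, of "axis undefined 1"] by simp
  have v_le: "norm (v k) \<le> K ^ k * norm x0" for k
  proof (induction k)
    case 0
    then show ?case by (simp add: v_def)
  next
    case (Suc k)
    have "norm (v (Suc k)) \<le> norm (v k) * K" by (simp add: v_Suc K)
    also have "\<dots> \<le> (K ^ k * norm x0) * K" using Suc \<open>K \<ge> 0\<close> by (rule mult_right_mono)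
    finally show ?case by (simp add: mult_ac)
  qed
  have summable_v: "summable (\<lambda>k. (t ^ k / fact k) *\<^sub>R v k)" for t :: real
  proof (rule summable_comparison_test')
    show "summable (\<lambda>k. ((\<bar>t\<bar> * K) ^ k /\<^sub>R fact k) * norm x0)"
      by (intro summable_mult2 summable_exp_generic)
    fix k
    show "norm ((t ^ k / fact k) *\<^sub>R v k) \<le> ((\<bar>t\<bar> * K) ^ k /\<^sub>R fact k) * norm x0"
      using mult_left_mono[OF v_le[of k], of "\<bar>t\<bar> ^ k / fact k"]
      by (simp add: power_abs power_mult_distrib field_simps)
  qed
  define x where "x t = (\<Sum>k. (t ^ k / fact k) *\<^sub>R v k)" for t :: real
  have x_inner: "x t \<bullet> b = (\<Sum>k. (v k \<bullet> b / fact k) * t ^ k)" for t b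
    unfolding x_def
    by (subst bounded_linear.suminf[OF bounded_linear_inner_left summable_v]) (simp add: mult_ac)
  have summable_inner: "summable (\<lambda>k. (v k \<bullet> b / fact k) * t ^ k)" for t b
    using bounded_linear.summable[OF bounded_linear_inner_left summable_v, of t b]
    by (simp add: mult_ac)
  have Ax: "A *v x t = (\<Sum>k. (t ^ k / fact k) *\<^sub>R v (Suc k))" for t
    unfolding x_def
    by (subst bounded_linear.suminf[OF matrix_vector_mul_bounded_linear summable_v])
      (simp add: v_Suc matrix_vector_mult_scaleR)
  have summable_Av: "summable (\<lambda>k. (t ^ k / fact k) *\<^sub>R v (Suc k))" for t
    using bounded_linear.summable[OF matrix_vector_mul_bounded_linear[of A] summable_v, of t]
    by (simp add: v_Suc matrix_vector_mult_scaleR)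
  \<comment> \<open>Applying \<open>A\<close> shifts the coefficients in the same way as termwise differentiation does.\<close>
  have Ax_inner: "(A *v x t) \<bullet> b = (\<Sum>k. diffs (\<lambda>k. v k \<bullet> b / fact k) k * t ^ k)" for t b
    unfolding Ax
    by (subst bounded_linear.suminf[OF bounded_linear_inner_left summable_Av])
      (simp add: diffs_def mult_ac fact_Suc del: of_nat_Suc)
  have deriv_inner: "((\<lambda>t. x t \<bullet> b) has_real_derivative (A *v x t) \<bullet> b) (at t)" for t b
    unfolding x_inner Ax_inner
    by (rule termdiffs_strong_converges_everywhere) (rule summable_inner)
  have "(x has_vector_derivative A *v x t) (at t within {0..})" for t
    unfolding has_vector_derivative_def
  proof (subst has_derivative_componentwise_within, intro ballI)
    fix b :: "real^'n"
    show "((\<lambda>t. x t \<bullet> b) has_derivative (\<lambda>h. (h *\<^sub>R (A *v x t)) \<bullet> b)) (at t within {0..})"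
      using has_field_derivative_at_within[OF deriv_inner[of b t]]
      by (simp add: has_field_derivative_def mult.commute[of _ "(A *v x t) \<bullet> b"]
          del: inner_real_def)
  qed
  then have "continuous_trajectory A x" by (simp add: continuous_trajectory_def)
  moreover have "x 0 = x0"
    unfolding x_def by (subst suminf_finite[of "{0}"]) (auto simp: v_def)
  ultimately show thesis by (rule that)
qed

lemma symmetric_form_commute:
  fixes Q :: "real^'n^'n"
  assumes "transpose Q = Q"
  shows "x \<bullet> (Q *v y) = y \<bullet> (Q *v x)"
  by (metis assms dot_lmul_matrix inner_commute transpose_matrix_vector)

text \<open>A positive right derivative of \<open>x \<bullet> (Q *v x)\<close> at time \<open>0\<close> would push the trajectory out of the
  ellipsoid immediately.\<close>

lemma boundary_point_dissipative:
  fixes A Q :: "real^'n^'n"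
  assumes sym: "transpose Q = Q"
    and inv: "continuous_invariant A (ellipsoid Q)"
    and bd: "x0 \<bullet> (Q *v x0) = 1"
  shows "x0 \<bullet> (Q *v (A *v x0)) \<le> 0"
proof (rule ccontr)
  assume "\<not> ?thesis"
  then have pos: "0 < 2 * (x0 \<bullet> (Q *v (A *v x0)))" by simp
  obtain x where x: "continuous_trajectory A x" "x 0 = x0"
    by (rule exists_continuous_trajectory)
  have dx: "(x has_vector_derivative A *v x0) (at 0 within {0..})"
    using x by (auto simp: continuous_trajectory_def)
  have "((\<lambda>t. x t \<bullet> (Q *v x t)) has_vector_derivative
      x 0 \<bullet> (Q *v (A *v x0)) + (A *v x0) \<bullet> (Q *v x 0)) (at 0 within {0..})"
    by (intro bounded_bilinear.has_vector_derivative[OF bounded_bilinear_inner] dx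
        bounded_linear.has_vector_derivative[OF matrix_vector_mul_bounded_linear])
  then have "((\<lambda>t. x t \<bullet> (Q *v x t)) has_real_derivative 2 * (x0 \<bullet> (Q *v (A *v x0))))
      (at 0 within {0..})"
    by (simp add: has_real_derivative_iff_has_vector_derivative x(2)
        symmetric_form_commute[OF sym, of "A *v x0"])
  from has_real_derivative_pos_inc_right[OF this pos]
  obtain d where d: "d > 0" "\<And>h. \<lbrakk>0 < h; h < d\<rbrakk> \<Longrightarrow> 1 < x h \<bullet> (Q *v x h)"
    by (auto simp: x(2) bd)
  have "x (d / 2) \<in> ellipsoid Q"
    using inv x d(1) bd by (simp add: continuous_invariant_def ellipsoid_def)
  moreover have "1 < x (d / 2) \<bullet> (Q *v x (d / 2))" using d by simp
  ultimately show False by (simp add: ellipsoid_def)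
qed

lemma invariant_imp_dissipative:
  fixes A Q :: "real^'n^'n"
  assumes Q: "symmetric_pos_def Q" and inv: "continuous_invariant A (ellipsoid Q)"
  shows "x \<bullet> (Q *v (A *v x)) \<le> 0"
proof (cases "x = 0")
  case False
  define q where "q = x \<bullet> (Q *v x)"
  have "q > 0" using Q False by (simp add: q_def symmetric_pos_def_def)
  \<comment> \<open>Rescaling \<open>x\<close> by \<open>c\<close> puts it on the boundary; the form is homogeneous of degree two.\<close>
  define c where "c = 1 / sqrt q"
  have c: "c > 0" "c * c * q = 1" using \<open>q > 0\<close> by (simp_all add: c_def)
  have "(c *\<^sub>R x) \<bullet> (Q *v (A *v (c *\<^sub>R x))) \<le> 0"
    using Q inv c(2)
    by (intro boundary_point_dissipative)
      (simp_all add: symmetric_pos_def_def matrix_vector_mult_scaleR q_def)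
  then show ?thesis
    using c(1) by (simp add: matrix_vector_mult_scaleR mult_le_0_iff)
qed simp

text \<open>Stepping backwards along a dissipative field increases the energy: in the expanded square, the
  cross term is nonnegative by dissipativity and the quadratic term by positivity of \<open>Q\<close>.\<close>

lemma dissipative_imp_backward_step_expands:
  fixes A Q :: "real^'n^'n"
  assumes Q: "symmetric_pos_def Q"
    and diss: "y \<bullet> (Q *v (A *v y)) \<le> 0"
    and "dt \<ge> 0"
  shows "y \<bullet> (Q *v y) \<le> ((mat 1 - dt *\<^sub>R A) *v y) \<bullet> (Q *v ((mat 1 - dt *\<^sub>R A) *v y))"
proof -
  let ?a = "A *v y"
  have sym: "transpose Q = Q" using Q by (simp add: symmetric_pos_def_def)
  have step: "(mat 1 - dt *\<^sub>R A) *v y = y - dt *\<^sub>R ?a"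
    by (simp add: matrix_vector_mult_diff_rdistrib scaleR_matrix_vector_assoc)
  have "(y - dt *\<^sub>R ?a) \<bullet> (Q *v (y - dt *\<^sub>R ?a))
      = y \<bullet> (Q *v y) - 2 * (dt * (y \<bullet> (Q *v ?a))) + dt * dt * (?a \<bullet> (Q *v ?a))"
    by (simp add: matrix_vector_mult_diff_distrib matrix_vector_mult_scaleR inner_diff_left
        inner_diff_right symmetric_form_commute[OF sym, of ?a y] algebra_simps)
  moreover have "dt * (y \<bullet> (Q *v ?a)) \<le> 0"
    using diss \<open>dt \<ge> 0\<close> by (simp add: mult_nonneg_nonpos)
  moreover have "0 \<le> ?a \<bullet> (Q *v ?a)"
    using Q by (cases "?a = 0") (auto simp: symmetric_pos_def_def intro: less_imp_le)
  then have "0 \<le> dt * dt * (?a \<bullet> (Q *v ?a))" by simp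
  ultimately show ?thesis unfolding step by linarith
qed

lemma dissipative_imp_backward_step_invertible:
  fixes A Q :: "real^'n^'n"
  assumes Q: "symmetric_pos_def Q"
    and diss: "\<And>y. y \<bullet> (Q *v (A *v y)) \<le> 0"
    and "dt \<ge> 0"
  shows "invertible (mat 1 - dt *\<^sub>R A)"
proof -
  have "y = 0" if "(mat 1 - dt *\<^sub>R A) *v y = 0" for y
  proof (rule ccontr)
    assume "y \<noteq> 0"
    then have "0 < y \<bullet> (Q *v y)" using Q by (simp add: symmetric_pos_def_def)
    then show False
      using dissipative_imp_backward_step_expands[OF Q diss \<open>dt \<ge> 0\<close>, of y] that by simp
  qed
  then show ?thesis
    by (simp add: invertible_left_inverse matrix_left_invertible_ker)
qed

lemma matrix_inv_right:
  fixes M :: "real^'n^'n"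
  assumes "invertible M"
  shows "M ** matrix_inv M = mat 1"
  using someI_ex[OF assms[unfolded invertible_def]] by (simp add: matrix_inv_def)

theorem theorem4p6:
  fixes A Q :: "real^'n^'n"
  assumes "symmetric_pos_def Q"
    and "continuous_invariant A (ellipsoid Q)"
  shows "\<exists>\<tau>>0. \<forall>dt\<in>{0..\<tau>}.
    invertible (mat 1 - dt *\<^sub>R A) \<and>
    (\<forall>x\<in>ellipsoid Q. backward_euler A dt *v x \<in> ellipsoid Q) \<and>
    discrete_invariant (backward_euler A dt) (ellipsoid Q)"
proof (intro exI[of _ 1] conjI ballI)
  note diss = invariant_imp_dissipative[OF assms]
  fix dt :: real
  assume "dt \<in> {0..1}"
  then have "dt \<ge> 0" by simp
  show inv: "invertible (mat 1 - dt *\<^sub>R A)"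
    using assms(1) diss \<open>dt \<ge> 0\<close> by (rule dissipative_imp_backward_step_invertible)
  show stays: "backward_euler A dt *v x \<in> ellipsoid Q" if "x \<in> ellipsoid Q" for x
  proof -
    have "(mat 1 - dt *\<^sub>R A) *v (backward_euler A dt *v x) = x"
      using inv by (simp add: backward_euler_def matrix_vector_mul_assoc matrix_inv_right)
    then show ?thesis
      using dissipative_imp_backward_step_expands[OF assms(1) diss \<open>dt \<ge> 0\<close>,
          of "backward_euler A dt *v x"] that
      by (simp add: ellipsoid_def)
  qed
  show "discrete_invariant (backward_euler A dt) (ellipsoid Q)"
    using stays by (simp add: discrete_invariant_def discrete_trajectory_def)
qed simp

end
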